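(* The least cardinality of a family of $\mathbb{Q}$-very meagre subsets of $\mathbb{R}$ whose union is $\mathbb{R}$ is equal to the least cardinality of a family of small subsets of ${}^{\omega}\mathbb{Z}$ whose union is ${}^{\omega}\mathbb{Z}$.
   Context: ${}^{\omega}\mathbb{Z}$ is the set of all functions $f:\omega\to\mathbb{Z}$, and each $n\in\omega$ is identified with $\{0,\dots,n-1\}$. A set $Y\subseteq\mathbb{R}$ is $\mathbb{Q}$-nowhere dense if for every $q\in\mathbb{Q}$ there is an integer $k\in\mathbb{Z}$, $k\neq 0$, such that the open interval whose endpoints are $q$ and $q+1/k$ is disjoint from $Y$. A set is $\mathbb{Q}$-very meagre if it is the union of countably many $\mathbb{Q}$-nowhere dense sets. A set $Y\subseteq{}^{\omega}\mathbb{Z}$ is small if for each $n\in\omega$ and each $\sigma:n\to\mathbb{Z}$ there is some $k\in\mathbb{Z}$ such that either $\{f(n): f\in Y,\ \sigma\subseteq f\}\subseteq\{m\in\mathbb{Z}: m<k\}$ or $\{f(n): f\in Y,\ \sigma\subseteq f\}\subseteq\{m\in\mathbb{Z}: m>k\}$. *)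

theory Defs
  imports Complex_Main "HOL-Library.Countable_Set"
begin

unbundle cardinal_syntax

definition Q_nowhere_dense :: "real set \<Rightarrow> bool" where
  "Q_nowhere_dense Y \<longleftrightarrow>
     (\<forall>q\<in>\<rat>. \<exists>k::int. k \<noteq> 0 \<and>
        {min q (q + 1 / of_int k)<..<max q (q + 1 / of_int k)} \<inter> Y = {})"

definition Q_very_meagre :: "real set \<Rightarrow> bool" where
  "Q_very_meagre Y \<longleftrightarrow>
     (\<exists>\<A>. countable \<A> \<and> (\<forall>A\<in>\<A>. Q_nowhere_dense A) \<and> Y = \<Union>\<A>)"

text \<open>A finite sequence \<open>\<sigma> : n \<rightarrow> \<int>\<close> is given by a total function of which only the
  restriction to \<open>{..<n}\<close> matters; \<open>\<sigma> \<subseteq> f\<close> is agreement on \<open>{..<n}\<close>.\<close>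

definition small :: "(nat \<Rightarrow> int) set \<Rightarrow> bool" where
  "small Y \<longleftrightarrow>
     (\<forall>n. \<forall>\<sigma>::nat \<Rightarrow> int. \<exists>k::int.
        {f n | f. f \<in> Y \<and> (\<forall>i<n. f i = \<sigma> i)} \<subseteq> {m. m < k} \<or>
        {f n | f. f \<in> Y \<and> (\<forall>i<n. f i = \<sigma> i)} \<subseteq> {m. m > k})"

text \<open>The least cardinality of a member of \<open>S\<close>, as a cardinal order; it is meaningful whenever
  \<open>S\<close> is nonempty.\<close>

definition least_card :: "'a set set \<Rightarrow> 'a rel" where
  "least_card S = |SOME A. A \<in> S \<and> (\<forall>B\<in>S. |A| \<le>o |B| )|"

lemma least_card_attained:
  assumes "S \<noteq> {}"
  shows "\<exists>A\<in>S. least_card S = |A| \<and> (\<forall>B\<in>S. |A| \<le>o |B| )"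
proof -
  have "\<exists>r\<in>card_of ` S. \<forall>r'\<in>card_of ` S. r \<le>o r'"
    using assms by (intro exists_minim_Well_order) (auto simp: card_of_Well_order)
  then have "\<exists>A. A \<in> S \<and> (\<forall>B\<in>S. |A| \<le>o |B| )" by auto
  from someI_ex[OF this] show ?thesis
    unfolding least_card_def by blast
qed

definition covers_by :: "('a set \<Rightarrow> bool) \<Rightarrow> 'a set set set" where
  "covers_by P = {F. (\<forall>A\<in>F. P A) \<and> \<Union>F = UNIV}"

lemma covers_by_Q_very_meagre_nonempty: "covers_by Q_very_meagre \<noteq> {}"
proof -
  have "Q_nowhere_dense {y}" for y :: real
    unfolding Q_nowhere_dense_def
  proof
    fix q :: real assume "q \<in> \<rat>"
    obtain k :: int where k: "k \<noteq> 0" "(y < q \<longleftrightarrow> k > 0)"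
      by (cases "y < q") (metis zero_less_one zero_neq_one, metis neg_less_0_iff_less order_less_asym zero_less_one zero_neq_neg_one)
    then show "\<exists>k::int. k \<noteq> 0 \<and>
        {min q (q + 1 / of_int k)<..<max q (q + 1 / of_int k)} \<inter> {y} = {}"
      by (intro exI[of _ k]) (auto simp: min_def max_def divide_simps split: if_splits)
  qed
  then have "Q_very_meagre {y}" for y :: real
    unfolding Q_very_meagre_def by (intro exI[of _ "{{y}}"]) auto
  then have "range (\<lambda>y::real. {y}) \<in> covers_by Q_very_meagre"
    by (auto simp: covers_by_def)
  then show ?thesis by blast
qed

lemma covers_by_small_nonempty: "covers_by small \<noteq> {}"
proof -
  have "small {f}" for f
    unfolding small_def by (intro allI, rule_tac x="f n + 1" in exI) auto
  then have "range (\<lambda>f. {f}) \<in> covers_by small"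
    by (auto simp: covers_by_def)
  then show ?thesis by blast
qed

end

theory Submission imports Defs "HOL-Library.Countable_Set_Type"
begin

text \<open>
  Each covering number bounds the other because of two maps: \<open>code\<close> from the reals to the integer
  sequences, under which preimages of small sets are \<open>\<rat>\<close>-nowhere dense, and \<open>decode\<close> in the
  opposite direction, under which preimages of \<open>\<rat>\<close>-nowhere dense sets are small. The link is that
  a node \<open>\<sigma>\<close> of the tree of finite sequences plays the part of a rational \<open>q\<close>: sending the next
  entry to \<open>\<infinity>\<close> or to \<open>-\<infinity>\<close> corresponds to approaching \<open>q\<close> from one side or from the other.

  For \<open>code\<close>, let \<open>q\<^sub>0, q\<^sub>1, \<dots>\<close> enumerate the rationals and let the \<open>n\<close>-th entry of \<open>code x\<close> be
  the integer part of \<open>\<surd>2 / (x - q\<^sub>n)\<close>. It tends to \<open>\<plusminus>\<infinity>\<close> as \<open>x\<close> approaches \<open>q\<^sub>n\<close> from the two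
  sides, whereas the entries before it do not change near \<open>q\<^sub>n\<close>: as \<open>\<surd>2\<close> is irrational,
  \<open>\<surd>2 / (q\<^sub>n - q\<^sub>i)\<close> is not an integer for \<open>i < n\<close> (\<open>code_locally_constant\<close>). A bound at the node of the
  first \<open>n\<close> entries therefore becomes a gap next to \<open>q\<^sub>n\<close> (\<open>Q_nowhere_dense_vimage_code\<close>).

  For \<open>decode\<close>, put \<open>w(k) = 1 / (6k + 3)\<close> and
  \<open>decode f = w(f 0) + w(f 0) w(f 1) + w(f 0) w(f 1) w(f 2) + \<dots>\<close>. Given the first \<open>n\<close> entries,
  \<open>decode f = q + P * decode g\<close> with \<open>q\<close> and \<open>P \<noteq> 0\<close> rational and \<open>g\<close> the remaining sequence.
  The first term dominates the series of \<open>g\<close>, so \<open>decode g\<close> has the sign of \<open>w(g 0)\<close> and tends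
  to \<open>0\<close> as \<open>g 0\<close> tends to \<open>\<plusminus>\<infinity>\<close>. A gap next to \<open>q\<close> therefore bounds the next entry on one side
  (\<open>small_vimage_decode\<close>).

  Preimages under \<open>code\<close> turn a small cover of the sequences into a cover of the line that is no
  larger. Conversely, each member of a \<open>\<rat>\<close>-very meagre cover \<open>F\<close> is split into countably many
  \<open>\<rat>\<close>-nowhere dense pieces, whose preimages under \<open>decode\<close> are small. This yields no more than
  \<open>|F|\<close> sets provided that \<open>F\<close> is infinite, and it is: otherwise countably many small sets would
  cover the sequences, which a diagonal argument excludes (\<open>no_countable_small_cover\<close>).
\<close>

section \<open>Pulling small sets back to the line\<close>

definition rat_enum :: "nat \<Rightarrow> real" where
  "rat_enum = from_nat_into \<rat>"

lemma bij_rat_enum: "bij_betw rat_enum UNIV \<rat>"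
proof -
  have "infinite (\<rat> :: real set)"
  proof
    assume "finite (\<rat> :: real set)"
    then have "finite (\<nat> :: real set)"
      using Nats_subset_Rats finite_subset by blast
    then show False
      unfolding Nats_def using finite_imageD[OF _ inj_of_nat] infinite_UNIV_nat by blast
  qed
  then show ?thesis
    unfolding rat_enum_def by (intro bij_betw_from_nat_into countable_rat)
qed

lemma sqrt_2_irrational: "sqrt 2 \<notin> \<rat>"
proof
  assume "sqrt 2 \<in> \<rat>"
  then obtain m n :: nat where n: "n \<noteq> 0" and mn: "\<bar>sqrt 2\<bar> = real m / real n" and "coprime m n"
    by (rule Rats_abs_nat_div_natE)
  have "real m = sqrt 2 * real n" using mn n by (simp add: field_simps)
  then have "(real m)\<^sup>2 = 2 * (real n)\<^sup>2" by (simp add: power_mult_distrib)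
  then have eq: "m\<^sup>2 = 2 * n\<^sup>2" by (metis of_nat_eq_iff of_nat_mult of_nat_numeral of_nat_power)
  then have "even m" by (metis dvd_triv_left even_power)
  then obtain k where "m = 2 * k" by blast
  then have "n\<^sup>2 = 2 * k\<^sup>2" using eq by (simp add: power_mult_distrib)
  then have "even n" by (metis dvd_triv_left even_power)
  with \<open>even m\<close> \<open>coprime m n\<close> show False by (auto simp: coprime_def)
qed

definition code :: "real \<Rightarrow> nat \<Rightarrow> int" where
  "code x n = \<lfloor>sqrt 2 / (x - rat_enum n)\<rfloor>"

lemma eventually_floor_eq:
  fixes h :: "real \<Rightarrow> real"
  assumes "isCont h a" and "h a \<notin> \<int>"
  shows "eventually (\<lambda>x. \<lfloor>h x\<rfloor> = \<lfloor>h a\<rfloor>) (nhds a)"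
proof -
  have "of_int \<lfloor>h a\<rfloor> < h a"
    using assms(2) by (metis Ints_of_int less_eq_real_def of_int_floor_le)
  moreover have "h a < of_int (\<lfloor>h a\<rfloor> + 1)" by linarith
  moreover have lim: "(h \<longlongrightarrow> h a) (nhds a)"
    using assms(1) by (simp add: isCont_def tendsto_at_iff_tendsto_nhds)
  ultimately have "eventually (\<lambda>x. of_int \<lfloor>h a\<rfloor> < h x \<and> h x < of_int (\<lfloor>h a\<rfloor> + 1)) (nhds a)"
    by (intro eventually_conj order_tendstoD)
  then show ?thesis
    by eventually_elim (auto simp: floor_eq_iff)
qed

text \<open>If \<open>sqrt 2 / (q\<^sub>n - q\<^sub>i)\<close> were an integer, multiplying it by the nonzero rational
  \<open>q\<^sub>n - q\<^sub>i\<close> would make \<open>sqrt 2\<close> rational.\<close>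

lemma code_locally_constant:
  assumes "i < n"
  shows "eventually (\<lambda>x. code x i = code (rat_enum n) i) (nhds (rat_enum n))"
proof -
  let ?d = "rat_enum n - rat_enum i"
  have nz: "?d \<noteq> 0"
    using bij_rat_enum assms by (auto simp: bij_betw_def inj_on_def)
  have d: "?d \<in> \<rat>"
    using bij_rat_enum by (intro Rats_diff) (auto simp: bij_betw_def)
  have "sqrt 2 / ?d \<notin> \<int>"
  proof
    assume "sqrt 2 / ?d \<in> \<int>"
    then have "sqrt 2 / ?d * ?d \<in> \<rat>"
      using d Ints_subset_Rats by (intro Rats_mult) auto
    then show False
      using nz sqrt_2_irrational by simp
  qed
  then show ?thesis
    unfolding code_def using nz by (intro eventually_floor_eq continuous_intros) auto
qed

text \<open>At \<open>q = q\<^sub>n\<close> the node to look at is \<open>code q\<close> below \<open>n\<close>. An upper bound for the next entry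
  forbids points just to the right of \<open>q\<close>, where that entry is large, and a lower bound forbids
  points just to the left.\<close>

lemma Q_nowhere_dense_vimage_code:
  assumes "small Y"
  shows "Q_nowhere_dense (code -` Y)"
  unfolding Q_nowhere_dense_def
proof
  fix q :: real assume "q \<in> \<rat>"
  then obtain n where q: "q = rat_enum n"
    using bij_rat_enum by (auto simp: bij_betw_def)
  obtain k where k: "{f n | f. f \<in> Y \<and> (\<forall>i<n. f i = code q i)} \<subseteq> {m. m < k} \<or>
      {f n | f. f \<in> Y \<and> (\<forall>i<n. f i = code q i)} \<subseteq> {m. m > k}"
    using assms unfolding small_def by meson
  have "eventually (\<lambda>x. \<forall>i\<in>{..<n}. code x i = code q i) (nhds q)"
    unfolding q by (intro eventually_ball_finite) (auto intro: code_locally_constant)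
  then obtain d where d: "d > 0" "\<And>x i. dist x q < d \<Longrightarrow> i < n \<Longrightarrow> code x i = code q i"
    unfolding eventually_nhds_metric by auto
  obtain N :: nat where N: "real N > max (1 / d) (max (\<bar>real_of_int k\<bar> + 1) 1)"
    using reals_Archimedean2 by blast
  have N0: "real N > 1" "N > 0" using N by auto
  have Nd: "1 / real N < d" using N d(1) N0 by (simp add: field_simps)
  have s: "sqrt 2 \<ge> (1::real)" by simp
  from k show "\<exists>k::int. k \<noteq> 0 \<and>
        {min q (q + 1 / of_int k)<..<max q (q + 1 / of_int k)} \<inter> code -` Y = {}"
  proof
    assume lt: "{f n | f. f \<in> Y \<and> (\<forall>i<n. f i = code q i)} \<subseteq> {m. m < k}"
    have "code x \<notin> Y" if x: "q < x" "x < q + 1 / real N" for x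
    proof
      assume "code x \<in> Y"
      moreover have "\<forall>i<n. code x i = code q i"
        using x Nd by (auto intro!: d(2) simp: dist_real_def)
      ultimately have "code x n < k" using lt by blast
      moreover have "real N < 1 / (x - q)" using x N0 by (simp add: field_simps)
      moreover have "1 / (x - q) \<le> sqrt 2 / (x - q)"
        using x s by (intro divide_right_mono) auto
      ultimately show False using N unfolding code_def q[symmetric] by linarith
    qed
    then show ?thesis using N0 by (intro exI[of _ "int N"]) auto
  next
    assume gt: "{f n | f. f \<in> Y \<and> (\<forall>i<n. f i = code q i)} \<subseteq> {m. m > k}"
    have "code x \<notin> Y" if x: "x < q" "q - 1 / real N < x" for x
    proof
      assume "code x \<in> Y"
      moreover have "\<forall>i<n. code x i = code q i"
        using x Nd by (auto intro!: d(2) simp: dist_real_def)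
      ultimately have "code x n > k" using gt by blast
      moreover have "real N < 1 / (q - x)" using x N0 by (simp add: field_simps)
      moreover have "1 / (q - x) \<le> sqrt 2 / (q - x)"
        using x s by (intro divide_right_mono) auto
      moreover have "sqrt 2 / (x - q) = - (sqrt 2 / (q - x))"
        by (metis minus_diff_eq minus_divide_right)
      ultimately show False using N unfolding code_def q[symmetric] by linarith
    qed
    then show ?thesis using N0 by (intro exI[of _ "- int N"]) auto
  qed
qed

section \<open>Pulling Q-nowhere dense sets back to the sequence space\<close>

text \<open>What matters about this choice: the values are rational, have the sign of \<open>k\<close> (with \<open>0\<close>
  counted as positive), never vanish, tend to \<open>0\<close> at \<open>\<plusminus>\<infinity>\<close>, and are at most \<open>1/3\<close> in absolute
  value.\<close>

definition weight :: "int \<Rightarrow> real" where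
  "weight k = 1 / (6 * of_int k + 3)"

lemma weight_nonzero: "weight k \<noteq> 0"
proof -
  have "6 * k + 3 \<noteq> 0" by presburger
  then have "real_of_int (6 * k + 3) \<noteq> 0" by (simp only: of_int_eq_0_iff not_False_eq_True)
  then show ?thesis unfolding weight_def by simp
qed

lemma abs_weight_le: "\<bar>weight k\<bar> \<le> 1 / 3"
proof -
  have "\<bar>6 * k + 3\<bar> \<ge> 3" by presburger
  then have "real_of_int \<bar>6 * k + 3\<bar> \<ge> 3" by linarith
  then have "\<bar>6 * real_of_int k + 3\<bar> \<ge> 3" by simp
  then show ?thesis unfolding weight_def by (simp add: field_simps)
qed

definition decode :: "(nat \<Rightarrow> int) \<Rightarrow> real" where
  "decode f = (\<Sum>n. \<Prod>i\<le>n. weight (f i))"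

lemma abs_prod_weight_le: "\<bar>\<Prod>i\<in>I. weight (f i)\<bar> \<le> (1 / 3) ^ card I"
proof -
  have "(\<Prod>i\<in>I. \<bar>weight (f i)\<bar>) \<le> (\<Prod>i\<in>I. 1 / 3)"
    by (intro prod_mono conjI abs_ge_zero abs_weight_le)
  then show ?thesis by (simp add: abs_prod)
qed

lemma sums_third: "(\<lambda>n. (1 / 3) ^ Suc n :: real) sums (1 / 2)"
  using sums_mult[OF geometric_sums[of "1 / 3 :: real"], of "1 / 3"] by simp

lemma summable_decode: "summable (\<lambda>n. \<Prod>i\<le>n. weight (f i))"
  using abs_prod_weight_le[of f "{.._}"]
  by (intro summable_comparison_test'[OF sums_summable[OF sums_third]]) auto

text \<open>A bound strictly below \<open>1\<close> is what makes the first term of the series decide its sign, and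
  the estimate \<open>\<bar>weight k\<bar> \<le> 1/3\<close> yields it, since \<open>1/3 + 1/9 + \<dots> = 1/2\<close>.\<close>

lemma abs_decode_le: "\<bar>decode f\<bar> \<le> 1 / 2"
  unfolding decode_def
  using norm_suminf_le[of "\<lambda>n. \<Prod>i\<le>n. weight (f i)" "\<lambda>n. (1 / 3) ^ Suc n"]
    abs_prod_weight_le[of f "{.._}"] sums_summable[OF sums_third] sums_unique[OF sums_third]
  by simp

lemma decode_unfold: "decode f = weight (f 0) * (1 + decode (\<lambda>m. f (Suc m)))"
proof -
  have "decode f = weight (f 0) + (\<Sum>n. \<Prod>i\<le>Suc n. weight (f i))"
    unfolding decode_def using suminf_split_head[OF summable_decode, of f] by simp
  also have "(\<Sum>n. \<Prod>i\<le>Suc n. weight (f i)) = weight (f 0) * decode (\<lambda>m. f (Suc m))"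
    unfolding decode_def prod.atMost_Suc_shift
    by (rule suminf_mult[OF summable_decode])
  finally show ?thesis by (simp add: algebra_simps)
qed

lemma decode_split:
  "decode f = (\<Sum>j<n. \<Prod>i\<le>j. weight (f i)) + (\<Prod>i<n. weight (f i)) * decode (\<lambda>m. f (n + m))"
proof (induction n)
  case (Suc n)
  have "decode (\<lambda>m. f (n + m)) = weight (f n) * (1 + decode (\<lambda>m. f (Suc n + m)))"
    by (subst decode_unfold) simp
  then show ?case
    using Suc by (simp add: algebra_simps lessThan_Suc_atMost[symmetric])
qed simp

lemma decode_pos:
  assumes "K > 0" "f 0 \<ge> K"
  shows "0 < decode f" "decode f < 1 / of_int K"
proof -
  let ?w = "weight (f 0)"
  have w: "0 < ?w" "?w * 6 * of_int K < 1"
    using assms unfolding weight_def by (auto simp: field_simps)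
  have d: "1 / 2 \<le> 1 + decode (\<lambda>m. f (Suc m))" "1 + decode (\<lambda>m. f (Suc m)) \<le> 3 / 2"
    using abs_decode_le[of "\<lambda>m. f (Suc m)"] by linarith+
  show "0 < decode f" using w d by (subst decode_unfold) auto
  have "decode f \<le> ?w * (3 / 2)"
    using w d by (subst decode_unfold) (intro mult_left_mono, auto)
  also have "\<dots> < 1 / of_int K" using w assms by (simp add: field_simps)
  finally show "decode f < 1 / of_int K" .
qed

lemma decode_neg:
  assumes "K > 0" "f 0 < - K"
  shows "decode f < 0" "- 1 / of_int K < decode f"
proof -
  let ?w = "- weight (f 0)"
  have "f 0 \<le> - K - 1" using assms by simp
  then have *: "6 * real_of_int (f 0) + 3 \<le> - 6 * of_int K - 3" by linarith
  have K: "real_of_int K > 0" using assms by simp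
  have w: "0 < ?w" "?w * 6 * of_int K < 1"
    using * K unfolding weight_def by (auto simp: field_simps)
  have d: "1 / 2 \<le> 1 + decode (\<lambda>m. f (Suc m))" "1 + decode (\<lambda>m. f (Suc m)) \<le> 3 / 2"
    using abs_decode_le[of "\<lambda>m. f (Suc m)"] by linarith+
  have eq: "- decode f = ?w * (1 + decode (\<lambda>m. f (Suc m)))"
    by (subst decode_unfold) simp
  have "0 < - decode f" unfolding eq using w d by (intro mult_pos_pos) auto
  then show "decode f < 0" by simp
  have "- decode f \<le> ?w * (3 / 2)"
    unfolding eq using w d by (intro mult_left_mono) auto
  also have "\<dots> < 1 / of_int K" using w K by (simp add: field_simps)
  finally show "- 1 / of_int K < decode f" by simp
qed

text \<open>Given a node \<open>\<sigma>\<close> of length \<open>n\<close>, let \<open>q\<close> be the sum of the terms already determined and \<open>P\<close>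
  the common factor of the remaining ones. If \<open>Y\<close> has a gap of length \<open>1 / \<bar>k\<bar>\<close> on one side of \<open>q\<close>,
  then an entry \<open>\<ge> \<bar>k\<bar>\<close> at \<open>n\<close> (if \<open>P\<close> has the sign of \<open>k\<close>) or an entry \<open>< - \<bar>k\<bar>\<close> (if the signs
  differ) would put \<open>decode f\<close> into the gap.\<close>

lemma small_vimage_decode:
  assumes "Q_nowhere_dense Y"
  shows "small (decode -` Y)"
  unfolding small_def
proof (intro allI)
  fix n and \<sigma> :: "nat \<Rightarrow> int"
  define q where "q = (\<Sum>j<n. \<Prod>i\<le>j. weight (\<sigma> i))"
  define P where "P = (\<Prod>i<n. weight (\<sigma> i))"
  have "weight k \<in> \<rat>" for k unfolding weight_def by simp
  then have "q \<in> \<rat>" unfolding q_def by (intro Rats_sum Rats_prod)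
  then obtain k :: int where k: "k \<noteq> 0"
      "{min q (q + 1 / of_int k)<..<max q (q + 1 / of_int k)} \<inter> Y = {}"
    using assms unfolding Q_nowhere_dense_def by blast
  have P0: "P \<noteq> 0" unfolding P_def by (simp add: weight_nonzero)
  have "\<bar>P\<bar> \<le> (1 / 3) ^ n" using abs_prod_weight_le[of \<sigma> "{..<n}"] unfolding P_def by simp
  also have "\<dots> \<le> 1" by (simp add: power_le_one)
  finally have P1: "\<bar>P\<bar> \<le> 1" .
  have eq: "decode f = q + P * decode (\<lambda>m. f (n + m))" if "\<forall>i<n. f i = \<sigma> i" for f
    
  proof -
    have "(\<Sum>j<n. \<Prod>i\<le>j. weight (f i)) = q"
      unfolding q_def using that by (intro sum.cong prod.cong) auto
    moreover have "(\<Prod>i<n. weight (f i)) = P"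
      unfolding P_def using that by (intro prod.cong) auto
    ultimately show ?thesis using decode_split[of f n] by simp
  qed
  \<comment> \<open>As \<open>\<bar>P\<bar> \<le> 1\<close>, a nonzero offset from \<open>q\<close> towards the gap must come from a tail
    \<open>decode (\<lambda>m. f (n + m))\<close> at least as long as the gap.\<close>
  have miss: "P * decode (\<lambda>m. f (n + m)) * of_int (sgn k) \<le> 0 \<or> \<bar>decode (\<lambda>m. f (n + m))\<bar> \<ge> 1 / of_int \<bar>k\<bar>"
    if f: "\<forall>i<n. f i = \<sigma> i" "decode f \<in> Y" for f
  proof (rule ccontr)
    let ?x = "decode (\<lambda>m. f (n + m))"
    assume "\<not> ?thesis"
    then have a: "P * ?x * of_int (sgn k) > 0" "\<bar>?x\<bar> < 1 / of_int \<bar>k\<bar>" by auto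
    have "\<bar>P * ?x\<bar> \<le> 1 * \<bar>?x\<bar>" unfolding abs_mult by (intro mult_right_mono P1) auto
    then have "\<bar>P * ?x\<bar> < 1 / of_int \<bar>k\<bar>" using a by linarith
    then have "q + P * ?x \<in> {min q (q + 1 / of_int k)<..<max q (q + 1 / of_int k)}"
      using a(1) k(1) by (cases "k > 0") (auto simp: min_def max_def)
    then show False using k(2) f eq[OF f(1)] by auto
  qed
  show "\<exists>k. {f n | f. f \<in> decode -` Y \<and> (\<forall>i<n. f i = \<sigma> i)} \<subseteq> {m. m < k} \<or>
            {f n | f. f \<in> decode -` Y \<and> (\<forall>i<n. f i = \<sigma> i)} \<subseteq> {m. m > k}"
  proof (cases "P * of_int (sgn k) > 0")
    case True
    have "f n < \<bar>k\<bar>" if f: "\<forall>i<n. f i = \<sigma> i" "decode f \<in> Y" for f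
    proof (rule ccontr)
      assume "\<not> f n < \<bar>k\<bar>"
      then have x: "0 < decode (\<lambda>m. f (n + m))" "decode (\<lambda>m. f (n + m)) < 1 / of_int \<bar>k\<bar>"
        using decode_pos[of "\<bar>k\<bar>" "\<lambda>m. f (n + m)"] k(1) by auto
      then have "P * decode (\<lambda>m. f (n + m)) * of_int (sgn k) > 0"
        using mult_pos_pos[OF True x(1)] by (simp add: mult_ac)
      then show False using miss[OF f] x by auto
    qed
    then show ?thesis by (intro exI[of _ "\<bar>k\<bar>"]) auto
  next
    case False
    then have neg: "P * of_int (sgn k) < 0"
      using P0 k(1) by (auto simp: not_less order_le_less sgn_eq_0_iff)
    have "f n > - \<bar>k\<bar> - 1" if f: "\<forall>i<n. f i = \<sigma> i" "decode f \<in> Y" for f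
    proof (rule ccontr)
      assume "\<not> f n > - \<bar>k\<bar> - 1"
      then have x: "decode (\<lambda>m. f (n + m)) < 0" "- 1 / of_int \<bar>k\<bar> < decode (\<lambda>m. f (n + m))"
        using decode_neg[of "\<bar>k\<bar>" "\<lambda>m. f (n + m)"] k(1) by auto
      then have "P * decode (\<lambda>m. f (n + m)) * of_int (sgn k) > 0"
        using mult_neg_neg[OF neg x(1)] by (simp add: mult_ac)
      then show False using miss[OF f] x by auto
    qed
    then show ?thesis by (intro exI[of _ "- \<bar>k\<bar> - 1"]) auto
  qed
qed

section \<open>Comparing the covering numbers\<close>

text \<open>Below every node a small set omits some value of the next entry, so a sequence can avoid the
  \<open>n\<close>-th of countably many small sets by its choice of the \<open>n\<close>-th entry alone.\<close>

lemma no_countable_small_cover: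
  assumes "countable F" and "\<And>Y. Y \<in> F \<Longrightarrow> small Y"
  shows "\<Union>F \<noteq> UNIV"
proof (cases "F = {}")
  case False
  define Y where "Y = from_nat_into F"
  have Y: "range Y = F"
    unfolding Y_def using False assms(1) by (rule range_from_nat_into)
  have "\<exists>f. \<forall>n. \<forall>h\<in>Y n. (\<forall>i<n. h i = f i) \<longrightarrow> h n \<noteq> f n"
  proof (rule dependent_wellorder_choice)
    fix n and f :: "nat \<Rightarrow> int"
    have "small (Y n)" using Y assms(2) by blast
    then obtain k where "{h n | h. h \<in> Y n \<and> (\<forall>i<n. h i = f i)} \<subseteq> {m. m < k} \<or>
        {h n | h. h \<in> Y n \<and> (\<forall>i<n. h i = f i)} \<subseteq> {m. m > k}"
      unfolding small_def by meson
    then show "\<exists>r. \<forall>h\<in>Y n. (\<forall>i<n. h i = f i) \<longrightarrow> h n \<noteq> r"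
      by (intro exI[of _ k]) blast
  qed simp
  then obtain f where f: "\<And>n h. h \<in> Y n \<Longrightarrow> (\<forall>i<n. h i = f i) \<Longrightarrow> h n \<noteq> f n"
    by blast
  then have "f \<notin> Y n" for n by blast
  then have "f \<notin> \<Union>F" using Y by blast
  then show ?thesis by blast
qed simp

lemma least_card_mono:
  assumes "S \<noteq> {}" and "T \<noteq> {}" and "\<And>F. F \<in> S \<Longrightarrow> \<exists>G\<in>T. |G| \<le>o |F|"
  shows "least_card T \<le>o least_card S"
proof -
  obtain F where F: "F \<in> S" "least_card S = |F|"
    using least_card_attained[OF assms(1)] by blast
  obtain G where G: "G \<in> T" "|G| \<le>o |F|" using assms(3)[OF F(1)] by blast
  obtain H where "least_card T = |H|" "|H| \<le>o |G|"
    using least_card_attained[OF assms(2)] G(1) by blast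
  then show ?thesis using F G ordLeq_transitive by metis
qed

lemma Q_very_meagre_cover_of_small_cover:
  assumes "F \<in> covers_by small"
  shows "\<exists>G\<in>covers_by Q_very_meagre. |G| \<le>o |F|"
proof
  show "(\<lambda>Y. code -` Y) ` F \<in> covers_by Q_very_meagre"
  proof -
    have "Q_very_meagre (code -` Y)" if "Y \<in> F" for Y
      unfolding Q_very_meagre_def
      using that assms Q_nowhere_dense_vimage_code
      by (intro exI[of _ "{code -` Y}"]) (auto simp: covers_by_def)
    moreover have "\<Union>F = UNIV" using assms by (simp add: covers_by_def)
    ultimately show ?thesis by (auto simp: covers_by_def simp flip: vimage_Union)
  qed
qed (rule card_of_image)

lemma small_cover_of_Q_very_meagre_cover:
  assumes "F \<in> covers_by Q_very_meagre"
  shows "\<exists>G\<in>covers_by small. |G| \<le>o |F|"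
proof -
  have "\<forall>A\<in>F. \<exists>\<A>. countable \<A> \<and> (\<forall>B\<in>\<A>. Q_nowhere_dense B) \<and> A = \<Union>\<A>"
    using assms by (auto simp: covers_by_def Q_very_meagre_def)
  then obtain D where D: "\<And>A. A \<in> F \<Longrightarrow> countable (D A)"
      "\<And>A B. A \<in> F \<Longrightarrow> B \<in> D A \<Longrightarrow> Q_nowhere_dense B" "\<And>A. A \<in> F \<Longrightarrow> A = \<Union>(D A)"
    by metis
  define G where "G = (\<Union>A\<in>F. (\<lambda>B. decode -` B) ` D A)"
  have small: "small Y" if "Y \<in> G" for Y
    using that D(2) small_vimage_decode unfolding G_def by blast
  have "\<Union>G = UNIV"
  proof (intro equalityI subsetI UNIV_I)
    fix f
    obtain A where "A \<in> F" "decode f \<in> A" using assms unfolding covers_by_def by blast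
    then show "f \<in> \<Union>G" using D(3)[of A] unfolding G_def by blast
  qed
  then have G: "G \<in> covers_by small" using small by (auto simp: covers_by_def)
  have "infinite F"
  proof
    assume "finite F"
    then have "countable G"
      unfolding G_def using D(1) by (intro countable_UN countable_image) (auto intro: countable_finite)
    then show False using no_countable_small_cover small \<open>\<Union>G = UNIV\<close> by blast
  qed
  moreover have "|(\<lambda>B. decode -` B) ` D A| \<le>o |F|" if "A \<in> F" for A
    using countable_image[OF D(1)[OF that]] \<open>infinite F\<close>
    by (meson countable_card_of_nat infinite_iff_card_of_nat ordLeq_transitive)
  ultimately have "|G| \<le>o |F|"
    unfolding G_def by (intro card_of_UNION_ordLeq_infinite) (auto intro: ordLeq_refl card_of_Card_order)
  then show ?thesis using G by blast
qed

theorem mainTheorem2: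
  "least_card (covers_by Q_very_meagre) =o least_card (covers_by small)"
  unfolding ordIso_iff_ordLeq
  using least_card_mono[OF covers_by_small_nonempty covers_by_Q_very_meagre_nonempty
      Q_very_meagre_cover_of_small_cover]
    least_card_mono[OF covers_by_Q_very_meagre_nonempty covers_by_small_nonempty
      small_cover_of_Q_very_meagre_cover] by blast

end
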